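(* Assume that $y=X\beta^*+\varepsilon$, where $\beta^*\succeq0$ has support $S=\{j:\beta_j^*>0\}$, $1\le|S|=s<n$, and $\varepsilon$ has i.i.d. zero-mean sub-Gaussian entries with parameter $\sigma$. With $\tau(S)>0$, $\beta_{\min}(S)$, $K(S)$ and $\phi_{\min}(S)$ as defined in the context, for $M\ge0$ set $$b=\frac{2(1+M)\,\sigma\sqrt{\frac{2\log p}{n}}}{\tau^2(S)},\qquad \widetilde{b}=b\cdot K(S)+\frac{(1+M)\,\sigma}{\sqrt{\phi_{\min}(S)}}\sqrt{\frac{2\log p}{n}}.$$ If $\beta_{\min}(S)>\widetilde{b}$, then the non-negative least squares estimator $\widehat{\beta}$ (a minimizer of $\min_{\beta\succeq0}\frac1n\|y-X\beta\|_2^2$) has the following properties with probability no less than $1-4p^{-M^2}$: $$\|\widehat{\beta}_{S^c}\|_1\le b\quad\text{and}\quad\|\widehat{\beta}_S-\beta_S^*\|_\infty\le\widetilde{b}.$$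
   Context: $X \in \mathbb{R}^{n\times p}$ is a deterministic design matrix with columns $X_1,\dots,X_p$ normalized such that $\|X_j\|_2^2 = n$ for $j=1,\dots,p$, and $\Sigma=\frac1nX^\top X$. For index sets $J,K$, $X_J$ is the submatrix of columns in $J$, $\Sigma_{JK}$ the submatrix with rows in $J$ and columns in $K$, $v_J$ the subvector of $v$ indexed by $J$, and $S^c=\{1,\dots,p\}\setminus S$. The symbol $\succeq$ denotes componentwise inequality and $\mathbf{1}$ is the vector of ones. A zero-mean random variable $Z$ is sub-Gaussian with parameter $\sigma>0$ if $\mathbf{E}[\exp(tZ)]\le\exp(\sigma^2t^2/2)$ for all $t\in\mathbb{R}$. Separating hyperplane constant: $$\tau(S)=\max\left\{\tau:\exists w\in\mathbb{R}^n,\ \|w\|_2\le1,\ \text{such that } \tfrac{1}{\sqrt n}X_S^\top w=0\ \text{and}\ \tfrac1{\sqrt n}X_{S^c}^\top w\succeq\tau\mathbf{1}\right\};$$ by convex duality $\tau^2(S)=\min\{\frac1n\|X_S\theta-X_{S^c}\lambda\|_2^2:\theta\in\mathbb{R}^s,\ \lambda\in\mathbb{R}^{p-s},\ \lambda\succeq0,\ \mathbf{1}^\top\lambda=1\}$. Further quantities ($\Sigma_{SS}$ is assumed invertible so that they make sense): $$\beta_{\min}(S)=\min_{j\in S}\beta_j^*,\quad K(S)=\max_{\|v\|_\infty=1}\|\Sigma_{SS}^{-1}v\|_\infty,\quad \phi_{\min}(S)=\min_{\|v\|_2=1}\|\Sigma_{SS}v\|_2.$$ *)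

theory Defs
  imports "HOL-Probability.Probability"
begin

text \<open>Vectors and matrices indexed by \<open>J\<close> (resp. \<open>J \<times> K\<close>) are represented
  inside the ambient types by padding with zeros. This preserves sums, products and all norms
  involved, so \<open>\<real>\<^sup>J\<close> is identified with \<open>coord_space J\<close>, and the
  identity matrix of size \<open>|J|\<close> with \<open>submat J J (mat 1)\<close>.\<close>

definition subvec :: "'p set \<Rightarrow> real ^ 'p \<Rightarrow> real ^ 'p"
  where "subvec J v = (\<chi> j. if j \<in> J then v $ j else 0)"

definition submat :: "'m set \<Rightarrow> 'p set \<Rightarrow> real ^ 'p ^ 'm \<Rightarrow> real ^ 'p ^ 'm"
  where "submat J K A = (\<chi> i j. if i \<in> J \<and> j \<in> K then A $ i $ j else 0)"

definition coord_space :: "'p set \<Rightarrow> (real ^ 'p) set"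
  where "coord_space J = {v. \<forall>j. j \<notin> J \<longrightarrow> v $ j = 0}"

definition is_inverse_on :: "'p::finite set \<Rightarrow> real ^ 'p ^ 'p \<Rightarrow> real ^ 'p ^ 'p \<Rightarrow> bool"
  where "is_inverse_on J A B \<longleftrightarrow> submat J J B = B \<and>
           submat J J A ** B = submat J J (mat 1) \<and> B ** submat J J A = submat J J (mat 1)"

definition invertible_on :: "'p::finite set \<Rightarrow> real ^ 'p ^ 'p \<Rightarrow> bool"
  where "invertible_on J A \<longleftrightarrow> (\<exists>B. is_inverse_on J A B)"

text \<open>The inverse of \<open>A\<^sub>J\<^sub>J\<close>; unique whenever it exists.\<close>

definition inv_on :: "'p::finite set \<Rightarrow> real ^ 'p ^ 'p \<Rightarrow> real ^ 'p ^ 'p"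
  where "inv_on J A = (SOME B. is_inverse_on J A B)"

definition l1norm :: "real ^ 'p::finite \<Rightarrow> real"
  where "l1norm v = (\<Sum>j\<in>UNIV. \<bar>v $ j\<bar>)"

definition gram :: "real ^ 'p ^ 'n::finite \<Rightarrow> real ^ 'p ^ 'p"
  where "gram X = (1 / real CARD('n)) *\<^sub>R (transpose X ** X)"

text \<open>For \<open>S \<noteq> UNIV\<close> the set below is nonempty, bounded above and closed (the
  unit ball is compact), so the supremum is the maximum. For \<open>S = UNIV\<close> there is no
  constraint on \<open>\<tau>\<close>, no maximum exists and the value is unspecified.\<close>

definition sep_const :: "real ^ 'p ^ 'n::finite \<Rightarrow> 'p set \<Rightarrow> real"
  where "sep_const X S = Sup {\<tau>. \<exists>w :: real ^ 'n. norm w \<le> 1 \<and>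
           (\<forall>j\<in>S. (1 / sqrt (real CARD('n))) * (column j X \<bullet> w) = 0) \<and>
           (\<forall>j\<in>-S. (1 / sqrt (real CARD('n))) * (column j X \<bullet> w) \<ge> \<tau>)}"

definition beta_min :: "real ^ 'p \<Rightarrow> 'p::finite set \<Rightarrow> real"
  where "beta_min \<beta> S = Min ((\<lambda>j. \<beta> $ j) ` S)"

text \<open>In the next two definitions \<open>v\<close> ranges over a unit sphere of
  \<open>\<real>\<^sup>S\<close>, which is compact and, for \<open>S \<noteq> {}\<close>, nonempty, so the
  extrema are attained.\<close>

definition K_const :: "real ^ 'p::finite ^ 'n::finite \<Rightarrow> 'p set \<Rightarrow> real"
  where "K_const X S =
    (SUP v\<in>{v \<in> coord_space S. infnorm v = 1}. infnorm (inv_on S (gram X) *v v))"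

definition phi_min :: "real ^ 'p::finite ^ 'n::finite \<Rightarrow> 'p set \<Rightarrow> real"
  where "phi_min X S =
    (INF v\<in>{v \<in> coord_space S. norm v = 1}. norm (submat S S (gram X) *v v))"

text \<open>Integrability of \<open>exp (t Z)\<close> has to be required explicitly, as the expectation of a
  non-integrable function is 0 by convention.\<close>

definition sub_gaussian :: "'w measure \<Rightarrow> ('w \<Rightarrow> real) \<Rightarrow> real \<Rightarrow> bool"
  where "sub_gaussian P Z \<sigma> \<longleftrightarrow>
    \<sigma> > 0 \<and> integrable P Z \<and> (\<integral>\<omega>. Z \<omega> \<partial>P) = 0 \<and>
    (\<forall>t. integrable P (\<lambda>\<omega>. exp (t * Z \<omega>)) \<and>
         (\<integral>\<omega>. exp (t * Z \<omega>) \<partial>P) \<le> exp (\<sigma>\<^sup>2 * t\<^sup>2 / 2))"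

definition nnls_minimizer ::
    "real ^ 'p::finite ^ 'n::finite \<Rightarrow> real ^ 'n \<Rightarrow> real ^ 'p \<Rightarrow> bool"
  where "nnls_minimizer X y =
    is_arg_min (\<lambda>\<beta>. (1 / real CARD('n)) * (norm (y - X *v \<beta>))\<^sup>2) (\<lambda>\<beta>. 0 \<le> \<beta>)"

end

theory Submission
  imports Defs
begin

text \<open>Dropping the sign constraints on \<open>S\<close> gives a relaxed problem. At any minimizer of it
  the residual is orthogonal to the columns in \<open>S\<close> and to \<open>X \<gamma>\<close>, where \<open>\<gamma>\<close> is the part of
  the minimizer off \<open>S\<close>. With \<open>Q\<close> the projection onto the orthogonal complement of
  the range of \<open>X\<^sub>S\<close> this yields \<open>\<parallel>Q X \<gamma>\<parallel>\<^sup>2 = \<langle>\<epsilon>, Q X \<gamma>\<rangle>\<close>; the separating hyperplane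
  bounds the left side below by \<open>n \<tau>\<^sup>2 \<parallel>\<gamma>\<parallel>\<^sub>1\<^sup>2\<close>, and if
  \<open>\<langle>Q X\<^sub>j, \<epsilon>\<rangle> \<le> n \<mu>\<close> for \<open>j \<notin> S\<close>, the right side is at most \<open>n \<mu> \<parallel>\<gamma>\<parallel>\<^sub>1\<close>. The part on \<open>S\<close> is
  then the least squares solution for \<open>y - X \<gamma>\<close>. Since \<open>\<beta>\<^sub>m\<^sub>i\<^sub>n\<close> exceeds the resulting error,
  relaxed minimizers are feasible for the original problem, so the minimizers of
  the latter are relaxed minimizers. The conditions on the noise hold by sub-Gaussian tail bounds
  and a union bound.\<close>

section \<open>Zero-padded subvectors and submatrices, and the Gram matrix\<close>

lemma subvec_nth [simp]: "subvec J v $ j = (if j \<in> J then v $ j else 0)"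
  by (simp add: subvec_def)

lemma subvec_coord_space [simp]: "subvec J v \<in> coord_space J"
  by (simp add: coord_space_def)

lemma subvec_eq: "v \<in> coord_space J \<Longrightarrow> subvec J v = v"
  by (auto simp: coord_space_def vec_eq_iff)

lemma subvec_add_Compl: "subvec J v + subvec (- J) v = v"
  by (simp add: vec_eq_iff)

lemma linear_subvec: "linear (subvec J)"
  by (rule linearI) (auto simp: vec_eq_iff)

lemma submat_mat_1_mult: "submat J J (mat 1) *v v = subvec J v"
  for v :: "real ^ 'p::finite"
proof -
  have "(\<Sum>k\<in>UNIV. (if j \<in> J \<and> k \<in> J then mat 1 $ j $ k else 0) * v $ k)
      = (\<Sum>k\<in>UNIV. if k = j then (if j \<in> J then v $ j else 0) else 0)" for j
    by (rule sum.cong) (auto simp: mat_def)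
  then show ?thesis
    by (simp add: vec_eq_iff matrix_vector_mult_def submat_def)
qed

lemma submat_mult: "v \<in> coord_space J \<Longrightarrow> submat J J A *v v = subvec J (A *v v)"
  for v :: "real ^ 'p::finite"
  by (auto simp: vec_eq_iff matrix_vector_mult_def submat_def coord_space_def intro!: sum.cong)

lemma submat_mult_coord_space: "submat J K A *v v \<in> coord_space J"
  for v :: "real ^ 'p::finite"
  by (simp add: matrix_vector_mult_def submat_def coord_space_def)

lemma matrix_mult_eq_sum: "A *v v = (\<Sum>j\<in>UNIV. v $ j *\<^sub>R column j A)"
  for A :: "real ^ 'p::finite ^ 'n::finite"
  by (simp add: matrix_mult_sum scalar_mult_eq_scaleR)

lemma transpose_mult_nth: "(transpose X *v z) $ j = column j X \<bullet> z"
  by (simp add: matrix_vector_mul_component transpose_def column_def inner_vec_def)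

lemma gram_mult_nth: "(gram X *v v) $ j = (column j X \<bullet> (X *v v)) / real CARD('n)"
  for X :: "real ^ 'p::finite ^ 'n::finite"
proof -
  have "gram X *v v = (1 / real CARD('n)) *\<^sub>R (transpose X *v (X *v v))"
    unfolding gram_def scaleR_matrix_vector_assoc[symmetric] matrix_vector_mul_assoc ..
  then show ?thesis
    by (simp only: transpose_mult_nth vector_scaleR_component) simp
qed

lemma gram_transpose: "transpose (gram X) = gram X"
  by (simp add: gram_def transpose_scalar matrix_transpose_mul)

lemma infnorm_leI:
  fixes v :: "real ^ 'p"
  assumes "\<And>j. \<bar>v $ j\<bar> \<le> c"
  shows "infnorm v \<le> c"
  unfolding infnorm_cart using assms by (intro cSup_least) auto

lemma norm_mult_le_onorm: "norm (A *v v) \<le> onorm ((*v) A) * norm v"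
  for A :: "real ^ 'p::finite ^ 'n::finite"
  by (rule onorm) (rule matrix_vector_mul_bounded_linear)

text \<open>First-order condition: if \<open>r \<bullet> v\<close> were nonzero, a short step along
  \<open>v\<close> or \<open>- v\<close> would shorten \<open>r\<close>. Only steps with
  \<open>\<bar>t\<bar> \<le> 1\<close> are tested, because in one of the later uses longer steps may
  leave the feasible set.\<close>

lemma inner_eq_0_if_norm_min:
  fixes r v :: "'a::euclidean_space"
  assumes "\<And>t. \<bar>t\<bar> \<le> 1 \<Longrightarrow> norm r \<le> norm (r - t *\<^sub>R v)"
  shows "r \<bullet> v = 0"
proof -
  have False if "r \<bullet> z > 0" "z = v \<or> z = - v" for z
  proof -
    obtain u where "u > 0" and u: "\<And>t. t > 0 \<Longrightarrow> t \<le> u \<Longrightarrow> norm (t *\<^sub>R z - r) < norm r"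
      using closer_points_lemma[OF \<open>r \<bullet> z > 0\<close>] by blast
    then have "norm (r - min u 1 *\<^sub>R z) < norm r"
      by (simp add: norm_minus_commute)
    then show False
      using that(2) assms[of "min u 1"] assms[of "- min u 1"] \<open>u > 0\<close> by auto
  qed
  from this[of v] this[of "- v"] show ?thesis
    by fastforce
qed

section \<open>Inverses of principal submatrices\<close>

lemma is_inverse_on_inv_on: "invertible_on J A \<Longrightarrow> is_inverse_on J A (inv_on J A)"
  unfolding invertible_on_def inv_on_def by (rule someI_ex)

lemma inv_on_mult_coord_space: "invertible_on J A \<Longrightarrow> inv_on J A *v v \<in> coord_space J"
  by (metis is_inverse_on_inv_on is_inverse_on_def submat_mult_coord_space)

lemma mult_inv_on:
  assumes "invertible_on J A"
  shows "subvec J (A *v (inv_on J A *v v)) = subvec J v"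
proof -
  let ?B = "inv_on J A"
  have "subvec J (A *v (?B *v v)) = submat J J A *v (?B *v v)"
    by (rule submat_mult[symmetric]) (rule inv_on_mult_coord_space[OF assms])
  also have "\<dots> = submat J J (mat 1) *v v"
    using is_inverse_on_inv_on[OF assms]
    by (simp only: is_inverse_on_def matrix_vector_mul_assoc)
  finally show ?thesis
    by (simp only: submat_mat_1_mult)
qed

lemma inv_on_mult:
  assumes "invertible_on J A" and "v \<in> coord_space J"
  shows "inv_on J A *v subvec J (A *v v) = v"
proof -
  have "inv_on J A *v subvec J (A *v v) = inv_on J A *v (submat J J A *v v)"
    by (simp only: submat_mult[OF assms(2)])
  also have "\<dots> = submat J J (mat 1) *v v"
    using is_inverse_on_inv_on[OF assms(1)]
    by (simp only: is_inverse_on_def matrix_vector_mul_assoc)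
  finally show ?thesis
    by (simp only: submat_mat_1_mult subvec_eq[OF assms(2)])
qed

lemma transpose_submat: "transpose (submat J K A) = submat K J (transpose A)"
  by (auto simp: transpose_def submat_def vec_eq_iff)

text \<open>Entry \<open>j\<close> of \<open>inv_on J A *v z\<close> is the inner product of
  \<open>z\<close> with row \<open>j\<close>, so the rows govern the size of single least squares
  coefficients. Transposing the left-inverse equation and using the symmetry of \<open>A\<close>
  shows that the transposed inverse is a right inverse.\<close>

lemma mult_row_inv_on:
  assumes "invertible_on J A" and "transpose A = A" and "j \<in> J"
  shows "row j (inv_on J A) \<in> coord_space J"
    and "subvec J (A *v row j (inv_on J A)) = axis j 1"
proof -
  let ?B = "inv_on J A"
  have B: "submat J J ?B = ?B" "?B ** submat J J A = submat J J (mat 1)"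
    using is_inverse_on_inv_on[OF assms(1)] by (auto simp: is_inverse_on_def)
  have row: "row j ?B = transpose ?B *v axis j 1"
    by (simp add: matrix_vector_mult_basis)
  have BT: "transpose ?B = submat J J (transpose ?B)"
    by (metis B(1) transpose_submat)
  show c: "row j ?B \<in> coord_space J"
    unfolding row by (subst BT) (rule submat_mult_coord_space)
  have "transpose (?B ** submat J J A) = submat J J A ** transpose ?B"
    by (simp add: matrix_transpose_mul transpose_submat assms(2))
  then have "submat J J A ** transpose ?B = submat J J (mat 1)"
    by (simp add: B(2) transpose_submat transpose_mat)
  then have "submat J J A *v row j ?B = subvec J (axis j 1)"
    unfolding row
    by (simp add: matrix_vector_mul_assoc submat_mat_1_mult del: transpose_matrix_vector)
  also have "\<dots> = axis j 1"
    using assms(3) by (auto simp: vec_eq_iff axis_def)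
  finally show "subvec J (A *v row j ?B) = axis j 1"
    by (simp add: submat_mult c)
qed

section \<open>The constants \<open>phi_min\<close> and \<open>K_const\<close>\<close>

text \<open>On the unit sphere the infimum is at least the reciprocal of the operator norm of the
  inverse, hence positive; the inequality is the definition rescaled to vectors of any
  length.\<close>

lemma phi_min_pos_le:
  fixes X :: "real ^ 'p::finite ^ 'n::finite"
  assumes inv: "invertible_on S (gram X)" and S: "S \<noteq> {}"
  shows "0 < phi_min X S"
    and "v \<in> coord_space S \<Longrightarrow> phi_min X S * norm v \<le> norm (subvec S (gram X *v v))"
proof -
  let ?V = "{v \<in> coord_space S. norm v = 1} :: (real ^ 'p) set"
  let ?f = "\<lambda>v. norm (submat S S (gram X) *v v)"
  let ?C = "onorm ((*v) (inv_on S (gram X)))"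
  obtain j where "j \<in> S" using S by blast
  then have ne: "axis j 1 \<in> ?V"
    by (simp add: coord_space_def) (auto simp: axis_def)
  have low: "1 \<le> ?C * ?f v" if "v \<in> ?V" for v
  proof -
    have "norm v = norm (inv_on S (gram X) *v (submat S S (gram X) *v v))"
      using that by (simp add: submat_mult inv_on_mult[OF inv])
    also have "\<dots> \<le> ?C * ?f v"
      by (rule norm_mult_le_onorm)
    finally show ?thesis using that by simp
  qed
  have C: "0 < ?C"
    using low[OF ne] norm_ge_zero[of "submat S S (gram X) *v axis j 1"]
      onorm_pos_le[OF matrix_vector_mul_bounded_linear, of "inv_on S (gram X)"]
    by (cases "?C = 0") auto
  have "1 / ?C \<le> phi_min X S"
    unfolding phi_min_def using ne low C
    by (intro cINF_greatest) (auto simp: field_simps)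
  with C show "0 < phi_min X S"
    by (meson less_le_trans zero_less_divide_1_iff)
  show "phi_min X S * norm v \<le> norm (subvec S (gram X *v v))" if v: "v \<in> coord_space S"
  proof (cases "v = 0")
    case False
    let ?u = "(1 / norm v) *\<^sub>R v"
    have "?u \<in> ?V"
      using v False by (auto simp: coord_space_def)
    then have "phi_min X S \<le> ?f ?u"
      unfolding phi_min_def by (intro cINF_lower bdd_belowI2[where m = 0]) auto
    also have "\<dots> = norm (subvec S (gram X *v v)) / norm v"
      by (simp add: matrix_vector_mult_scaleR submat_mult[OF v])
    finally show ?thesis
      using False by (simp add: field_simps)
  qed auto
qed

lemma K_const_nonneg_bound:
  fixes X :: "real ^ 'p::finite ^ 'n::finite"
  assumes S: "S \<noteq> {}"
  shows "0 \<le> K_const X S"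
    and "v \<in> coord_space S \<Longrightarrow> infnorm (inv_on S (gram X) *v v) \<le> K_const X S * infnorm v"
proof -
  let ?V = "{v \<in> coord_space S. infnorm v = 1} :: (real ^ 'p) set"
  let ?B = "inv_on S (gram X)"
  obtain j where "j \<in> S" using S by blast
  have inf1: "infnorm (axis j 1 :: real ^ 'p) = 1"
    using component_le_infnorm_cart[of "axis j 1 :: real ^ 'p" j] infnorm_le_norm[of "axis j 1 :: real ^ 'p"]
    by simp
  have ne: "axis j 1 \<in> ?V"
    using \<open>j \<in> S\<close> inf1 by (auto simp: coord_space_def axis_def)
  \<comment> \<open>A supremum yields upper bounds only for a set that is bounded above; here the
    operator norm and the equivalence of norms provide this.\<close>
  have bdd: "bdd_above ((\<lambda>v. infnorm (?B *v v)) ` ?V)"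
  proof (rule bdd_aboveI2)
    fix v assume v: "v \<in> ?V"
    have "infnorm (?B *v v) \<le> norm (?B *v v)"
      by (rule infnorm_le_norm)
    also have "\<dots> \<le> onorm ((*v) ?B) * norm v"
      by (rule norm_mult_le_onorm)
    also have "\<dots> \<le> onorm ((*v) ?B) * sqrt DIM(real ^ 'p)"
      using norm_le_infnorm[of v] v
      by (intro mult_left_mono onorm_pos_le matrix_vector_mul_bounded_linear) auto
    finally show "infnorm (?B *v v) \<le> onorm ((*v) ?B) * sqrt DIM(real ^ 'p)" .
  qed
  have up: "infnorm (?B *v v) \<le> K_const X S" if "v \<in> ?V" for v
    unfolding K_const_def using that bdd by (intro cSUP_upper) auto
  from up[OF ne] show "0 \<le> K_const X S"
    using infnorm_pos_le order_trans by blast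
  show "infnorm (?B *v v) \<le> K_const X S * infnorm v" if v: "v \<in> coord_space S"
  proof (cases "v = 0")
    case False
    let ?u = "(1 / infnorm v) *\<^sub>R v"
    have pos: "infnorm v > 0"
      using False by (simp add: infnorm_pos_lt)
    then have "?u \<in> ?V"
      using v by (auto simp: coord_space_def infnorm_mul)
    from up[OF this] pos show ?thesis
      by (simp add: matrix_vector_mult_scaleR infnorm_mul field_simps)
  qed (simp add: infnorm_0)
qed

section \<open>Preliminaries on the l1 norm and inner products\<close>

lemma l1norm_nonneg: "0 \<le> l1norm v"
  by (simp add: l1norm_def sum_nonneg)

lemma l1norm_eq_sum: "0 \<le> v \<Longrightarrow> l1norm v = (\<Sum>j\<in>UNIV. v $ j)"
  unfolding l1norm_def less_eq_vec_def by (intro sum.cong) auto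

lemma inner_mult_eq: "(transpose A *v z) \<bullet> v = z \<bullet> (A *v v)"
  for A :: "real ^ 'p::finite ^ 'n::finite"
  by (simp add: dot_lmul_matrix)

lemma inner_subvec: "v \<in> coord_space J \<Longrightarrow> v \<bullet> subvec J w = v \<bullet> w"
  for v :: "real ^ 'p::finite"
  by (auto simp: inner_vec_def coord_space_def intro!: sum.cong)

lemma orthogonal_mult_coord_space:
  fixes A :: "real ^ 'p::finite ^ 'n::finite"
  assumes "v \<in> coord_space J" and "\<And>j. j \<in> J \<Longrightarrow> column j A \<bullet> r = 0"
  shows "(A *v v) \<bullet> r = 0"
  unfolding matrix_mult_eq_sum inner_sum_left
  using assms by (intro sum.neutral) (auto simp: coord_space_def)

section \<open>Least squares on \<open>S\<close> and the projection \<open>resid\<close>\<close>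

locale nnls_design =
  fixes X :: "real ^ 'p::finite ^ 'n::finite" and S :: "'p set"
  assumes column_norm: "(norm (column j X))\<^sup>2 = real CARD('n)"
    and invertible: "invertible_on S (gram X)"
    and nonempty: "S \<noteq> {}"
    and sep_pos: "0 < sep_const X S"
begin

text \<open>\<open>resid\<close> is the orthogonal projection \<open>Q\<close> with kernel the range of \<open>X\<^sub>S\<close>.\<close>

definition coef :: "real ^ 'n \<Rightarrow> real ^ 'p"
  where "coef z = inv_on S (gram X) *v subvec S ((1 / real CARD('n)) *\<^sub>R (transpose X *v z))"

definition resid :: "real ^ 'n \<Rightarrow> real ^ 'n"
  where "resid z = z - X *v coef z"

lemma coef_coord_space: "coef z \<in> coord_space S"
  unfolding coef_def by (rule inv_on_mult_coord_space[OF invertible])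

lemma linear_coef: "linear coef"
proof (rule linearI)
  interpret sub: linear "subvec S :: real ^ 'p \<Rightarrow> _" by (rule linear_subvec)
  show "coef (x + y) = coef x + coef y" for x y
    unfolding coef_def
    by (simp only: matrix_vector_right_distrib scaleR_add_right sub.add)
  show "coef (c *\<^sub>R x) = c *\<^sub>R coef x" for c x
    unfolding coef_def matrix_vector_mult_scaleR scaleR_left_commute[of "1 / real CARD('n)"]
      sub.scale ..
qed

lemma linear_resid: "linear resid"
  unfolding resid_def
  by (intro linear_compose_sub linear_id[unfolded id_def] matrix_vector_mul_linear
      linear_compose[OF linear_coef, unfolded o_def])

lemma column_orthogonal_resid:
  assumes "j \<in> S"
  shows "column j X \<bullet> resid z = 0"
proof -
  have "subvec S (gram X *v coef z) $ j
      = subvec S ((1 / real CARD('n)) *\<^sub>R (transpose X *v z)) $ j"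
    unfolding coef_def mult_inv_on[OF invertible] by (auto simp: vec_eq_iff)
  then have "column j X \<bullet> (X *v coef z) = column j X \<bullet> z"
    using assms by (simp add: gram_mult_nth transpose_mult_nth del: transpose_matrix_vector)
  then show ?thesis
    by (simp add: resid_def inner_diff_right)
qed

lemma mult_orthogonal_resid: "v \<in> coord_space S \<Longrightarrow> (X *v v) \<bullet> resid z = 0"
  by (rule orthogonal_mult_coord_space[OF _ column_orthogonal_resid])

text \<open>The orthogonality conditions are the normal equations for regressing \<open>z\<close> on
  the columns in \<open>S\<close>; invertibility leaves them a single solution, which is
  \<open>coef z\<close>.\<close>

lemma coef_unique:
  assumes d: "d \<in> coord_space S" and orth: "\<And>j. j \<in> S \<Longrightarrow> column j X \<bullet> (z - X *v d) = 0"
  shows "coef z = d"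
proof -
  have "subvec S (gram X *v d) = subvec S ((1 / real CARD('n)) *\<^sub>R (transpose X *v z))"
    using orth
    by (auto simp: vec_eq_iff gram_mult_nth transpose_mult_nth inner_diff_right
        simp del: transpose_matrix_vector)
  then show ?thesis
    unfolding coef_def using inv_on_mult[OF invertible d] by simp
qed

lemma norm_resid_le: "norm (resid z) \<le> norm z"
proof -
  have "orthogonal (resid z) (X *v coef z)"
    using mult_orthogonal_resid[OF coef_coord_space, of z z]
    by (simp add: orthogonal_def inner_commute)
  from norm_add_Pythagorean[OF this]
  have "(norm z)\<^sup>2 = (norm (resid z))\<^sup>2 + (norm (X *v coef z))\<^sup>2"
    by (simp add: resid_def)
  then show ?thesis
    by (simp add: power2_le_imp_le)
qed

text \<open>Each coefficient becomes the inner product of \<open>z\<close> with a fixed vector, the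
  form to which the sub-Gaussian tail bound applies when \<open>z\<close> is the noise.\<close>

lemma coef_nth: "coef z $ j = (1 / real CARD('n)) *\<^sub>R (X *v row j (inv_on S (gram X))) \<bullet> z"
  if "j \<in> S"
proof -
  let ?r = "row j (inv_on S (gram X))"
  have r: "?r \<in> coord_space S"
    by (rule mult_row_inv_on[OF invertible gram_transpose that])
  have "inv_on S (gram X) $ j = ?r"
    by (simp add: row_def vec_eq_iff)
  then have "coef z $ j = ?r \<bullet> ((1 / real CARD('n)) *\<^sub>R (transpose X *v z))"
    unfolding coef_def matrix_vector_mul_component by (simp only: inner_subvec[OF r])
  then show ?thesis
    by (simp only: inner_scaleR_right inner_scaleR_left inner_commute[of _ z]
        inner_commute[of ?r "transpose X *v z"] inner_mult_eq)
qed

text \<open>For the row \<open>r\<close>, the value \<parallel>X r\<parallel>^2 / n is the quadratic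
  form of the Gram matrix at \<open>r\<close>, which equals entry \<open>j\<close> of
  \<open>r\<close> because the Gram matrix on \<open>S\<close> sends \<open>r\<close> to
  \<open>axis j 1\<close>. The same fact gives \<parallel>r\<parallel> \<le> 1 /
  \<open>phi_min X S\<close>.\<close>

lemma norm_coef_row:
  assumes "j \<in> S"
  shows "norm ((1 / real CARD('n)) *\<^sub>R (X *v row j (inv_on S (gram X))))
    \<le> 1 / sqrt (phi_min X S * real CARD('n))"
proof -
  let ?r = "row j (inv_on S (gram X))" and ?n = "real CARD('n)"
  have r: "?r \<in> coord_space S" and gr: "subvec S (gram X *v ?r) = axis j 1"
    by (rule mult_row_inv_on[OF invertible gram_transpose assms])+
  note phi = phi_min_pos_le[OF invertible nonempty]
  have "(norm (X *v ?r))\<^sup>2 = (transpose X *v (X *v ?r)) \<bullet> ?r"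
    by (simp only: power2_norm_eq_inner inner_mult_eq)
  also have "transpose X *v (X *v ?r) = ?n *\<^sub>R (gram X *v ?r)"
    by (simp add: vec_eq_iff gram_mult_nth transpose_mult_nth del: transpose_matrix_vector)
  also have "\<dots> \<bullet> ?r = ?n * (?r \<bullet> (gram X *v ?r))"
    by (simp only: inner_scaleR_left inner_commute[of ?r])
  also have "?r \<bullet> (gram X *v ?r) = ?r \<bullet> axis j 1"
    using inner_subvec[OF r] gr by metis
  also have "\<dots> \<le> norm ?r"
    using norm_cauchy_schwarz[of ?r "axis j 1"] by simp
  also have "\<dots> \<le> 1 / phi_min X S"
    using phi(2)[OF r] phi(1) by (simp add: gr field_simps)
  finally have "(norm (X *v ?r))\<^sup>2 \<le> ?n * (1 / phi_min X S)"
    by simp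
  then have "(norm (X *v ?r))\<^sup>2 / ?n\<^sup>2 \<le> ?n * (1 / phi_min X S) / ?n\<^sup>2"
    by (rule divide_right_mono) simp
  then have "(norm ((1 / ?n) *\<^sub>R (X *v ?r)))\<^sup>2 \<le> 1 / (phi_min X S * ?n)"
    by (simp add: power_divide power2_eq_square field_simps)
  then show ?thesis
    by (metis real_le_rsqrt real_sqrt_divide real_sqrt_one)
qed

lemma norm_column: "norm (column j X) = sqrt (real CARD('n))"
  by (metis column_norm norm_ge_zero real_sqrt_unique)

lemma norm_mult_le_l1norm: "norm (X *v v) \<le> sqrt (real CARD('n)) * l1norm v"
proof -
  have "norm (X *v v) \<le> (\<Sum>j\<in>UNIV. norm (v $ j *\<^sub>R column j X))"
    unfolding matrix_mult_eq_sum by (rule norm_sum)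
  then show ?thesis
    by (simp add: norm_column l1norm_def sum_distrib_left mult.commute)
qed

text \<open>By the column normalization all entries of the Gram matrix are at most 1 in absolute
  value, so applying it to \<open>v\<close> gives entries bounded by \<open>l1norm v\<close>;
  \<open>K_const\<close> then accounts for the inverse.\<close>

lemma infnorm_coef_mult_le: "infnorm (coef (X *v v)) \<le> K_const X S * l1norm v"
proof -
  have "\<bar>column j X \<bullet> (X *v v)\<bar> \<le> real CARD('n) * l1norm v" for j
  proof -
    have "\<bar>column j X \<bullet> (X *v v)\<bar> \<le> norm (column j X) * norm (X *v v)"
      by (rule Cauchy_Schwarz_ineq2)
    also have "\<dots> \<le> norm (column j X) * (norm (column j X) * l1norm v)"
      using norm_mult_le_l1norm[of v] by (intro mult_left_mono) (auto simp: norm_column)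
    finally show ?thesis
      by (simp add: column_norm[of j, symmetric] power2_eq_square)
  qed
  then have "infnorm (subvec S ((1 / real CARD('n)) *\<^sub>R (transpose X *v (X *v v)))) \<le> l1norm v"
    by (intro infnorm_leI)
      (auto simp: transpose_mult_nth l1norm_nonneg field_simps simp del: transpose_matrix_vector)
  then show ?thesis
    unfolding coef_def
    using K_const_nonneg_bound[OF nonempty, where X = X]
    by (meson mult_left_mono order_trans subvec_coord_space)
qed

section \<open>The separating hyperplane and the relaxed problem\<close>

text \<open>Weak duality: a vector \<open>w\<close> of the unit ball that is orthogonal to the
  columns in \<open>S\<close> and has margin \<tau> on the others does not see \<open>d\<close>, and
  pairs with \<open>X *v \<gamma>\<close> to at least \<tau> times \<open>?c\<close>. Arguing by
  contradiction produces an attained margin \<tau> above \<open>?N / ?c\<close>.\<close>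

lemma sep_const_le:
  assumes \<gamma>: "0 \<le> \<gamma>" "\<gamma> \<in> coord_space (- S)" and d: "d \<in> coord_space S"
  shows "sep_const X S * (sqrt (real CARD('n)) * l1norm \<gamma>) \<le> norm (X *v (\<gamma> + d))"
proof (rule ccontr)
  let ?c = "sqrt (real CARD('n)) * l1norm \<gamma>" and ?N = "norm (X *v (\<gamma> + d))"
  let ?A = "{\<tau>. \<exists>w :: real ^ 'n. norm w \<le> 1 \<and>
    (\<forall>j\<in>S. (1 / sqrt (real CARD('n))) * (column j X \<bullet> w) = 0) \<and>
    (\<forall>j\<in>-S. (1 / sqrt (real CARD('n))) * (column j X \<bullet> w) \<ge> \<tau>)}"
  assume "\<not> ?thesis"
  then have less: "?N < sep_const X S * ?c" by simp
  have c: "0 < ?c"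
    using less norm_ge_zero[of "X *v (\<gamma> + d)"] sep_pos by (metis le_less_trans zero_less_mult_pos)
  then have lt: "?N / ?c < Sup ?A"
    using less by (simp add: sep_const_def divide_less_eq)
  \<comment> \<open>The choice \<open>w = 0\<close> has margin 0; extracting an element close to the
    supremum requires a nonempty set.\<close>
  have "0 \<in> ?A"
    by (auto intro!: exI[of _ 0])
  then have "?A \<noteq> {}"
    by blast
  from less_cSupE[OF lt this] obtain \<tau> where "\<tau> \<in> ?A" and \<tau>: "?N / ?c < \<tau>" .
  then obtain w :: "real ^ 'n" where w: "norm w \<le> 1"
    and wS: "\<And>j. j \<in> S \<Longrightarrow> column j X \<bullet> w = 0"
    and wSc: "\<And>j. j \<notin> S \<Longrightarrow> (1 / sqrt (real CARD('n))) * (column j X \<bullet> w) \<ge> \<tau>"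
    by auto
  have "\<tau> * ?c = (\<Sum>j\<in>UNIV. \<gamma> $ j * (\<tau> * sqrt (real CARD('n))))"
    unfolding l1norm_eq_sum[OF \<gamma>(1)] sum_distrib_right[symmetric] by simp
  also have "\<dots> \<le> (\<Sum>j\<in>UNIV. \<gamma> $ j * (column j X \<bullet> w))"
  proof (rule sum_mono)
    fix j
    show "\<gamma> $ j * (\<tau> * sqrt (real CARD('n))) \<le> \<gamma> $ j * (column j X \<bullet> w)"
    proof (cases "j \<in> S")
      case False
      then have "\<tau> * sqrt (real CARD('n)) \<le> column j X \<bullet> w"
        using wSc by (simp add: field_simps)
      then show ?thesis
        using \<gamma>(1) by (intro mult_left_mono) (auto simp: less_eq_vec_def)
    next
      case True
      with \<gamma>(2) show ?thesis by (simp add: coord_space_def)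
    qed
  qed
  also have "\<dots> = (X *v \<gamma>) \<bullet> w"
    by (simp add: matrix_mult_eq_sum inner_sum_left)
  also have "\<dots> = (X *v (\<gamma> + d)) \<bullet> w"
    using orthogonal_mult_coord_space[OF d wS]
    by (simp add: matrix_vector_right_distrib inner_add_left)
  also have "\<dots> \<le> ?N * norm w"
    by (rule norm_cauchy_schwarz)
  also have "\<dots> \<le> ?N"
    using w by (simp add: mult_left_le)
  finally show False
    using \<tau> c by (simp add: field_simps)
qed

definition relaxed :: "(real ^ 'p) set"
  where "relaxed = {\<beta>. \<forall>j\<in>- S. 0 \<le> \<beta> $ j}"

text \<open>The deterministic core: \<mu> controls the noise after projection off the range of the
  columns in \<open>S\<close>, and \<kappa> its regression on these columns.\<close>

lemma relaxed_minimizer_bounds: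
  assumes rel: "\<beta> \<in> relaxed"
    and min: "\<And>\<beta>'. \<beta>' \<in> relaxed \<Longrightarrow> norm (y - X *v \<beta>) \<le> norm (y - X *v \<beta>')"
    and y: "y = X *v \<beta>s + e" and \<beta>s: "\<beta>s \<in> coord_space S"
    and \<mu>: "0 \<le> \<mu>" "\<And>j. j \<notin> S \<Longrightarrow> resid (column j X) \<bullet> e \<le> real CARD('n) * \<mu>"
    and \<kappa>: "0 \<le> \<kappa>" "\<And>j. j \<in> S \<Longrightarrow> \<bar>coef e $ j\<bar> \<le> \<kappa>"
  shows "l1norm (subvec (- S) \<beta>) \<le> \<mu> / (sep_const X S)\<^sup>2"
    and "infnorm (subvec S \<beta> - \<beta>s) \<le> \<mu> / (sep_const X S)\<^sup>2 * K_const X S + \<kappa>"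
proof -
  interpret coef: linear coef by (rule linear_coef)
  interpret resid: linear resid by (rule linear_resid)
  define \<gamma> where "\<gamma> = subvec (- S) \<beta>"
  define d where "d = subvec S \<beta> - \<beta>s"
  define r where "r = y - X *v \<beta>"
  define \<rho> where "\<rho> = resid (X *v \<gamma>)"
  have \<gamma>_nonneg: "0 \<le> \<gamma>"
    using rel by (auto simp: \<gamma>_def relaxed_def less_eq_vec_def)
  have \<gamma>: "\<gamma> \<in> coord_space (- S)"
    by (simp add: \<gamma>_def)
  have d: "d \<in> coord_space S"
    using \<beta>s by (auto simp: d_def coord_space_def)
  have "\<beta> = d + \<gamma> + \<beta>s"
    using subvec_add_Compl[of S \<beta>] by (simp add: d_def \<gamma>_def algebra_simps)
  then have r: "r = (e - X *v \<gamma>) - X *v d"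
    by (simp add: r_def y algebra_simps)
  \<comment> \<open>Optimality gives an equation along directions in which steps of both signs stay
    feasible.\<close>
  have stationary: "r \<bullet> (X *v v) = 0" if "\<And>t. \<bar>t\<bar> \<le> 1 \<Longrightarrow> \<beta> + t *\<^sub>R v \<in> relaxed" for v
  proof (rule inner_eq_0_if_norm_min)
    fix t :: real assume "\<bar>t\<bar> \<le> 1"
    from min[OF that[OF this]] show "norm r \<le> norm (r - t *\<^sub>R (X *v v))"
      by (simp add: r_def algebra_simps)
  qed
  \<comment> \<open>Coordinates in \<open>S\<close> are unconstrained, so the normal equations hold
    there and identify \<open>d\<close> as a regression coefficient.\<close>
  have "column j X \<bullet> r = 0" if "j \<in> S" for j
    using stationary[of "axis j 1"] that rel
    by (auto simp: relaxed_def axis_def inner_commute simp flip: matrix_vector_mult_basis)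
  then have coef_d: "coef (e - X *v \<gamma>) = d"
    by (intro coef_unique d) (simp add: r)
  then have r_resid: "r = resid e - \<rho>"
    by (simp add: r \<rho>_def resid_def[of "e - X *v \<gamma>"] flip: resid.diff)
  \<comment> \<open>Complementary slackness: scaling \<gamma> by \<open>1 + t\<close> with
    \<open>\<bar>t\<bar> \<le> 1\<close> preserves its signs.\<close>
  have "r \<bullet> (X *v \<gamma>) = 0"
  proof (rule stationary)
    fix t :: real assume "\<bar>t\<bar> \<le> 1"
    then have "0 \<le> (1 + t) * \<beta> $ j" if "j \<notin> S" for j
      using rel that by (intro mult_nonneg_nonneg) (auto simp: relaxed_def)
    then show "\<beta> + t *\<^sub>R \<gamma> \<in> relaxed"
      by (simp add: relaxed_def \<gamma>_def algebra_simps)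
  qed
  moreover have "r \<bullet> (X *v coef (X *v \<gamma>)) = 0"
    using mult_orthogonal_resid[OF coef_coord_space]
    by (simp add: r_resid \<rho>_def inner_diff_left inner_commute[of "resid _"])
  ultimately have "r \<bullet> \<rho> = 0"
    by (simp add: \<rho>_def resid_def inner_diff_right)
  then have "(norm \<rho>)\<^sup>2 = resid e \<bullet> \<rho>"
    by (simp add: r_resid inner_diff_left power2_norm_eq_inner)
  \<comment> \<open>\<open>e\<close> and \<open>resid e\<close> differ by a combination of columns
    in \<open>S\<close>, to which \<rho> is orthogonal.\<close>
  also have "\<dots> = e \<bullet> \<rho>"
    using mult_orthogonal_resid[OF coef_coord_space, of e]
    by (simp add: resid_def[of e] \<rho>_def inner_diff_left)
  also have "\<dots> = (\<Sum>j\<in>UNIV. \<gamma> $ j * (resid (column j X) \<bullet> e))"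
    unfolding \<rho>_def matrix_mult_eq_sum resid.sum resid.scale inner_sum_right
    by (simp add: inner_commute)
  \<comment> \<open>As \<gamma> is nonnegative, one-sided bounds on the projected noise
    suffice.\<close>
  also have "\<dots> \<le> (\<Sum>j\<in>UNIV. \<gamma> $ j * (real CARD('n) * \<mu>))"
  proof (rule sum_mono)
    fix j
    show "\<gamma> $ j * (resid (column j X) \<bullet> e) \<le> \<gamma> $ j * (real CARD('n) * \<mu>)"
      using \<gamma>_nonneg \<gamma> \<mu>(2)[of j]
      by (cases "j \<in> S") (auto simp: coord_space_def less_eq_vec_def intro!: mult_left_mono)
  qed
  also have "\<dots> = real CARD('n) * (\<mu> * l1norm \<gamma>)"
    unfolding l1norm_eq_sum[OF \<gamma>_nonneg] sum_distrib_right[symmetric] by simp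
  finally have upper: "(norm \<rho>)\<^sup>2 \<le> real CARD('n) * (\<mu> * l1norm \<gamma>)" .
  have "\<rho> = X *v (\<gamma> + (- coef (X *v \<gamma>)))"
    by (simp add: \<rho>_def resid_def matrix_vector_mult_diff_distrib)
  moreover have "- coef (X *v \<gamma>) \<in> coord_space S"
    using coef_coord_space by (auto simp: coord_space_def)
  ultimately have "sep_const X S * (sqrt (real CARD('n)) * l1norm \<gamma>) \<le> norm \<rho>"
    using sep_const_le[OF \<gamma>_nonneg \<gamma>] by metis
  then have "(sep_const X S * (sqrt (real CARD('n)) * l1norm \<gamma>))\<^sup>2 \<le> (norm \<rho>)\<^sup>2"
    using sep_pos l1norm_nonneg[of \<gamma>] by (intro power_mono) auto
  then have "real CARD('n) * ((sep_const X S)\<^sup>2 * (l1norm \<gamma>)\<^sup>2) \<le> (norm \<rho>)\<^sup>2"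
    by (simp add: power_mult_distrib mult_ac)
  from order_trans[OF this upper]
  have "(sep_const X S)\<^sup>2 * (l1norm \<gamma>)\<^sup>2 \<le> \<mu> * l1norm \<gamma>"
    by (rule mult_left_le_imp_le) simp
  then have "((sep_const X S)\<^sup>2 * l1norm \<gamma>) * l1norm \<gamma> \<le> \<mu> * l1norm \<gamma>"
    by (simp add: power2_eq_square mult_ac)
  \<comment> \<open>One factor \<open>l1norm \<gamma>\<close> cancels; if it vanishes, the claim is
    \<open>0 \<le> \<mu>\<close>.\<close>
  then have "(sep_const X S)\<^sup>2 * l1norm \<gamma> \<le> \<mu>"
    using l1norm_nonneg[of \<gamma>] \<mu>(1) by (cases "l1norm \<gamma> = 0") auto
  then have l1: "l1norm \<gamma> \<le> \<mu> / (sep_const X S)\<^sup>2"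
    using sep_pos by (simp add: field_simps)
  then show "l1norm (subvec (- S) \<beta>) \<le> \<mu> / (sep_const X S)\<^sup>2"
    by (simp add: \<gamma>_def)
  have "infnorm (coef e) \<le> \<kappa>"
    using \<kappa> coef_coord_space[of e] by (intro infnorm_leI) (force simp: coord_space_def)
  moreover have "infnorm (coef (X *v \<gamma>)) \<le> \<mu> / (sep_const X S)\<^sup>2 * K_const X S"
    using infnorm_coef_mult_le[of \<gamma>] l1 K_const_nonneg_bound(1)[OF nonempty, of X]
    by (metis mult.commute mult_left_mono order_trans)
  \<comment> \<open>The error on \<open>S\<close> splits into the regression of the noise and the
    shift caused by the mass off \<open>S\<close>.\<close>
  moreover have "d = coef e + (- coef (X *v \<gamma>))"
    using coef_d by (simp add: coef.diff)
  then have "infnorm d \<le> infnorm (coef e) + infnorm (coef (X *v \<gamma>))"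
    using infnorm_triangle[of "coef e" "- coef (X *v \<gamma>)"] by (simp add: infnorm_neg)
  ultimately show "infnorm (subvec S \<beta> - \<beta>s) \<le> \<mu> / (sep_const X S)\<^sup>2 * K_const X S + \<kappa>"
    by (simp add: d_def)
qed

text \<open>\<open>X\<close> may have a kernel, so the objective need not be coercive on the whole
  space. On \<open>relaxed\<close>, the separating constant bounds the part off \<open>S\<close> by
  the fitted values, and invertibility on \<open>S\<close> then bounds the rest, so sublevel sets
  are compact.\<close>

lemma relaxed_minimizer_exists:
  "\<exists>\<beta>\<in>relaxed. \<forall>\<beta>'\<in>relaxed. norm (y - X *v \<beta>) \<le> norm (y - X *v \<beta>')"
proof -
  let ?s = "sqrt (real CARD('n))"
  define C where "C = relaxed \<inter> {\<beta>. norm (y - X *v \<beta>) \<le> norm y}"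
  \<comment> \<open>On \<open>C\<close> the fitted values have norm at most
    \<open>2 * norm y\<close>; \<open>sep_const_le\<close> turns this into the bound
    \<open>c\<close> on the l1 norm off \<open>S\<close>.\<close>
  define c where "c = 2 * norm y / (sep_const X S * ?s)"
  obtain B where "B > 0" and B: "\<And>z. norm (coef z) \<le> B * norm z"
    using linear_bounded_pos[OF linear_coef] by blast
  have cont: "continuous_on A (\<lambda>\<beta>. norm (y - X *v \<beta>))" for A
    by (intro continuous_intros matrix_vector_mult_linear_continuous_on)
  have "norm \<beta> \<le> c + B * (2 * norm y + ?s * c)" if "\<beta> \<in> C" for \<beta>
  proof -
    let ?\<gamma> = "subvec (- S) \<beta>" and ?d = "subvec S \<beta>"
    have \<gamma>: "0 \<le> ?\<gamma>"
      using that by (auto simp: C_def relaxed_def less_eq_vec_def)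
    have \<beta>: "\<beta> = ?\<gamma> + ?d"
      by (simp add: vec_eq_iff)
    have "norm (X *v \<beta>) \<le> 2 * norm y"
      using that norm_triangle_ineq2[of "X *v \<beta>" y] by (simp add: C_def norm_minus_commute)
    moreover have "sep_const X S * (?s * l1norm ?\<gamma>) \<le> norm (X *v \<beta>)"
      by (subst \<beta>) (rule sep_const_le[OF \<gamma>], auto)
    ultimately have l1: "l1norm ?\<gamma> \<le> c"
      using sep_pos by (simp add: c_def field_simps)
    have "norm (X *v ?\<gamma>) \<le> ?s * c"
      using norm_mult_le_l1norm[of ?\<gamma>] l1 by (smt (verit) mult_left_mono real_sqrt_ge_zero of_nat_0_le_iff)
    moreover have "X *v ?d = X *v \<beta> - X *v ?\<gamma>"
      by (subst (2) \<beta>) (simp add: matrix_vector_right_distrib)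
    ultimately have "norm (X *v ?d) \<le> 2 * norm y + ?s * c"
      using norm_triangle_ineq4[of "X *v \<beta>" "X *v ?\<gamma>"] \<open>norm (X *v \<beta>) \<le> 2 * norm y\<close> by simp
    moreover have "coef (X *v ?d) = ?d"
      by (rule coef_unique) auto
    ultimately have "norm ?d \<le> B * (2 * norm y + ?s * c)"
      using B[of "X *v ?d"] \<open>B > 0\<close> by (smt (verit) mult_left_mono)
    moreover have "norm ?\<gamma> \<le> c"
      using norm_le_l1_cart[of ?\<gamma>] l1 by (simp add: l1norm_def)
    ultimately show ?thesis
      using norm_triangle_ineq[of ?\<gamma> ?d] \<beta> by simp
  qed
  then have "bounded C"
    by (auto intro: boundedI)
  moreover have "closed relaxed"
    unfolding relaxed_def Ball_def
    by (intro closed_Collect_all closed_Collect_imp closed_Collect_le continuous_intros) auto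
  then have "closed C"
    unfolding C_def by (intro closed_Int closed_Collect_le cont continuous_intros)
  moreover have "0 \<in> C"
    by (simp add: C_def relaxed_def)
  ultimately obtain \<beta> where \<beta>: "\<beta> \<in> C"
    and min: "\<And>\<beta>'. \<beta>' \<in> C \<Longrightarrow> norm (y - X *v \<beta>) \<le> norm (y - X *v \<beta>')"
    using continuous_attains_inf[OF _ _ cont, of C] by (auto simp: compact_eq_bounded_closed)
  \<comment> \<open>Relaxed points outside \<open>C\<close> have objective above
    \<open>norm y\<close>, which in turn bounds the value at \<beta>.\<close>
  have "norm (y - X *v \<beta>) \<le> norm (y - X *v \<beta>')" if "\<beta>' \<in> relaxed" for \<beta>'
    using \<beta> min[of \<beta>'] that by (cases "\<beta>' \<in> C") (auto simp: C_def)
  with \<beta> show ?thesis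
    by (auto simp: C_def)
qed

lemma nnls_minimizer_bounds:
  assumes \<beta>: "nnls_minimizer X y \<beta>"
    and y: "y = X *v \<beta>s + e" and \<beta>s: "\<beta>s \<in> coord_space S"
    and \<mu>: "0 \<le> \<mu>" "\<And>j. j \<notin> S \<Longrightarrow> resid (column j X) \<bullet> e \<le> real CARD('n) * \<mu>"
    and \<kappa>: "0 \<le> \<kappa>" "\<And>j. j \<in> S \<Longrightarrow> \<bar>coef e $ j\<bar> \<le> \<kappa>"
    and beta_min: "\<mu> / (sep_const X S)\<^sup>2 * K_const X S + \<kappa> < beta_min \<beta>s S"
  shows "l1norm (subvec (- S) \<beta>) \<le> \<mu> / (sep_const X S)\<^sup>2"
    and "infnorm (subvec S \<beta> - \<beta>s) \<le> \<mu> / (sep_const X S)\<^sup>2 * K_const X S + \<kappa>"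
proof -
  obtain \<beta>0 where \<beta>0: "\<beta>0 \<in> relaxed"
    and min: "\<And>\<beta>'. \<beta>' \<in> relaxed \<Longrightarrow> norm (y - X *v \<beta>0) \<le> norm (y - X *v \<beta>')"
    using relaxed_minimizer_exists[of y] by blast
  note bound = relaxed_minimizer_bounds(2)[OF \<beta>0 min y \<beta>s \<mu> \<kappa>]
  have "0 \<le> \<beta>0 $ j" for j
  proof (cases "j \<in> S")
    case True
    have "beta_min \<beta>s S \<le> \<beta>s $ j"
      unfolding beta_min_def using True by (intro Min_le) auto
    moreover have "\<bar>\<beta>0 $ j - \<beta>s $ j\<bar> \<le> infnorm (subvec S \<beta>0 - \<beta>s)"
      using component_le_infnorm_cart[of "subvec S \<beta>0 - \<beta>s" j] True by simp
    ultimately show ?thesis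
      using bound beta_min by linarith
  next
    case False
    with \<beta>0 show ?thesis by (simp add: relaxed_def)
  qed
  then have "0 \<le> \<beta>0"
    by (simp add: less_eq_vec_def)
  \<comment> \<open>\<open>\<beta>0\<close> now competes in the original problem, so \<beta> itself
    attains the relaxed minimum and inherits the bounds, whichever minimizer it is.\<close>
  then have "norm (y - X *v \<beta>) \<le> norm (y - X *v \<beta>0)"
    using \<beta> by (fastforce simp: nnls_minimizer_def is_arg_min_def not_less divide_le_cancel)
  then have "norm (y - X *v \<beta>) \<le> norm (y - X *v \<beta>')" if "\<beta>' \<in> relaxed" for \<beta>'
    using min[OF that] by linarith
  moreover have "\<beta> \<in> relaxed"
    using \<beta> by (auto simp: nnls_minimizer_def is_arg_min_def relaxed_def less_eq_vec_def)
  ultimately show "l1norm (subvec (- S) \<beta>) \<le> \<mu> / (sep_const X S)\<^sup>2"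
    and "infnorm (subvec S \<beta> - \<beta>s) \<le> \<mu> / (sep_const X S)\<^sup>2 * K_const X S + \<kappa>"
    using relaxed_minimizer_bounds[OF _ _ y \<beta>s \<mu> \<kappa>] by blast+
qed

end

section \<open>Measurability of the event\<close>

text \<open>The complement is the projection of a countable union of compact sets. Measurability of the
  event in the theorem is essential, as \<open>measure\<close> is 0 on non-measurable sets.\<close>

lemma borel_Collect_section_subset:
  fixes R :: "('a::euclidean_space \<times> 'b::euclidean_space) set"
  assumes R: "closed R" and G: "closed G"
  shows "{z. \<forall>x. (z, x) \<in> R \<longrightarrow> x \<in> G} \<in> sets borel"
proof -
  obtain D where D: "countable D" "D \<subseteq> Pow (- G)" "\<And>K. K \<in> D \<Longrightarrow> \<exists>a b. K = cbox a b" "\<Union>D = - G"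
    using open_countable_Union_open_cbox[of "- G"] G by auto
  let ?P = "\<lambda>K m. fst ` (R \<inter> (cball 0 (real m) \<times> K))"
  have "compact (?P K m)" if "K \<in> D" for K m
    using D(3)[OF that] R
    by (intro compact_continuous_image continuous_intros closed_Int_compact compact_Times compact_cball) auto
  then have "(\<Union>K\<in>D. \<Union>m. ?P K m) \<in> sets borel"
    using D(1) by (intro sets.countable_UN' sets.countable_UN) (auto intro: borel_compact)
  moreover have "{z. \<forall>x. (z, x) \<in> R \<longrightarrow> x \<in> G} = - (\<Union>K\<in>D. \<Union>m. ?P K m)"
  proof (intro set_eqI iffI)
    fix z assume "z \<in> {z. \<forall>x. (z, x) \<in> R \<longrightarrow> x \<in> G}"
    then show "z \<in> - (\<Union>K\<in>D. \<Union>m. ?P K m)"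
      using D(2) by fastforce
  next
    fix z assume z: "z \<in> - (\<Union>K\<in>D. \<Union>m. ?P K m)"
    have False if R: "(z, x) \<in> R" and "x \<notin> G" for x
    proof -
      obtain K where "K \<in> D" "x \<in> K"
        using D(4) \<open>x \<notin> G\<close> by blast
      moreover obtain m where "norm z \<le> real m"
        using real_arch_simple by blast
      ultimately have "z \<in> ?P K m"
        using R by force
      with z \<open>K \<in> D\<close> show False by blast
    qed
    then show "z \<in> {z. \<forall>x. (z, x) \<in> R \<longrightarrow> x \<in> G}" by blast
  qed
  ultimately show ?thesis
    by (simp only: borel_comp)
qed

text \<open>Optimality against one fixed competitor is a closed condition on the pair of response
  and estimate; full optimality intersects these conditions over all competitors.\<close>

lemma closed_nnls_minimizer:
  fixes X :: "real ^ 'p::finite ^ 'n::finite"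
  shows "closed {(z, \<beta>). nnls_minimizer X z \<beta>}"
proof -
  have "{(z, \<beta>). nnls_minimizer X z \<beta>} = {q. \<forall>j. 0 \<le> snd q $ j} \<inter>
      {q. \<forall>\<beta>'. 0 \<le> \<beta>' \<longrightarrow> norm (fst q - X *v snd q) \<le> norm (fst q - X *v \<beta>')}"
    by (fastforce simp: nnls_minimizer_def is_arg_min_def not_less divide_le_cancel less_eq_vec_def)
  also have "closed \<dots>"
    by (intro closed_Int closed_Collect_all closed_Collect_imp closed_Collect_le continuous_intros
        continuous_on_compose2[OF matrix_vector_mult_linear_continuous_on]) auto
  finally show ?thesis .
qed

text \<open>Minimizers may fail to be unique, so the event quantifies over all of them and no
  measurable selection is made.\<close>

lemma borel_nnls_event:
  fixes X :: "real ^ 'p::finite ^ 'n::finite"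
  shows "{z. \<forall>\<beta>. nnls_minimizer X z \<beta> \<longrightarrow>
    l1norm (subvec J \<beta>) \<le> b \<and> infnorm (subvec K \<beta> - c) \<le> bt} \<in> sets borel"
proof -
  have sub: "continuous_on A (subvec I)" for A and I :: "'p set"
    by (intro linear_continuous_on linear_linear[THEN iffD2] linear_subvec)
  have "closed {\<beta>. l1norm (subvec J \<beta>) \<le> b \<and> infnorm (subvec K \<beta> - c) \<le> bt}"
    unfolding l1norm_def by (intro closed_Collect_conj closed_Collect_le continuous_intros sub)
  from borel_Collect_section_subset[OF closed_nnls_minimizer[of X] this]
  show ?thesis by simp
qed

section \<open>Sub-Gaussian tails\<close>

lemma borel_measurable_vecI:
  fixes f :: "'a \<Rightarrow> real ^ 'n::finite"
  assumes "\<And>i. (\<lambda>\<omega>. f \<omega> $ i) \<in> borel_measurable M"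
  shows "f \<in> borel_measurable M"
  unfolding borel_measurable_euclidean_space[of f]
  using assms by (auto simp: Basis_vec_def inner_axis)

text \<open>Chernoff bound: by independence the exponential moment of
  \<open>a \<bullet> \<epsilon>\<close> factorizes, so this variable is sub-Gaussian with parameter
  \<sigma> \<parallel>a\<parallel>. The bound \<open>r\<close> replaces the norm so that one
  threshold serves a whole family of vectors.\<close>

lemma (in prob_space) sub_gaussian_inner_tail:
  fixes \<epsilon> :: "'a \<Rightarrow> real ^ 'n::finite"
  assumes indep: "indep_vars (\<lambda>_. borel) (\<lambda>i \<omega>. \<epsilon> \<omega> $ i) UNIV"
    and sg: "\<And>i. sub_gaussian M (\<lambda>\<omega>. \<epsilon> \<omega> $ i) \<sigma>"
    and r: "norm a \<le> r" and t: "0 \<le> t"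
  shows "prob {\<omega> \<in> space M. \<sigma> * r * t < a \<bullet> \<epsilon> \<omega>} \<le> exp (- (t\<^sup>2 / 2))"
proof -
  have \<sigma>: "\<sigma> > 0"
    using sg by (simp add: sub_gaussian_def)
  have rv: "(\<lambda>\<omega>. \<epsilon> \<omega> $ i) \<in> borel_measurable M" for i
    using indep by (auto simp: indep_vars_def)
  have \<epsilon>[measurable]: "\<epsilon> \<in> borel_measurable M"
    by (rule borel_measurable_vecI[OF rv])
  \<comment> \<open>The Chernoff parameter must be well defined and positive, which sets apart
    \<open>a = 0\<close> (empty event) and \<open>t = 0\<close> (bound 1).\<close>
  consider "a = 0" | "t = 0" | "0 < r" "0 < t"
    using r t by (metis less_le less_le_trans zero_less_norm_iff)
  then show ?thesis
  proof cases
    case 1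
    then have "{\<omega> \<in> space M. \<sigma> * r * t < a \<bullet> \<epsilon> \<omega>} = {}"
      using \<sigma> r t by (auto simp: not_less)
    then show ?thesis by (simp only: measure_empty exp_ge_zero)
  next
    case 3
    \<comment> \<open>This value minimizes the exponent - s \<sigma> r t + \<sigma>^2 s^2 r^2 / 2;
      the minimum is - t^2 / 2.\<close>
    define s where "s = t / (\<sigma> * r)"
    have s: "s > 0"
      using 3 \<sigma> by (simp add: s_def)
    have prod: "exp (s * (a \<bullet> \<epsilon> \<omega>)) = (\<Prod>i\<in>UNIV. exp ((s * a $ i) * \<epsilon> \<omega> $ i))" for \<omega>
      by (simp add: inner_vec_def sum_distrib_left mult_ac flip: exp_sum)
    have indep': "indep_vars (\<lambda>_. borel) (\<lambda>i \<omega>. exp ((s * a $ i) * \<epsilon> \<omega> $ i)) UNIV"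
      by (rule indep_vars_compose2[OF indep]) measurable
    have int_i: "integrable M (\<lambda>\<omega>. exp ((s * a $ i) * \<epsilon> \<omega> $ i))" for i
      using sg by (simp add: sub_gaussian_def)
    have int: "integrable M (\<lambda>\<omega>. exp (s * (a \<bullet> \<epsilon> \<omega>)))"
      unfolding prod by (rule indep_vars_integrable[OF _ indep' int_i]) simp
    have "expectation (\<lambda>\<omega>. exp (s * (a \<bullet> \<epsilon> \<omega>)))
        = (\<Prod>i\<in>UNIV. expectation (\<lambda>\<omega>. exp ((s * a $ i) * \<epsilon> \<omega> $ i)))"
      unfolding prod by (rule indep_vars_lebesgue_integral[OF _ indep' int_i]) simp
    also have "\<dots> \<le> (\<Prod>i\<in>UNIV. exp (\<sigma>\<^sup>2 * (s * a $ i)\<^sup>2 / 2))"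
      using sg by (intro prod_mono) (auto simp: sub_gaussian_def)
    also have "\<dots> = exp (\<sigma>\<^sup>2 * s\<^sup>2 * (norm a)\<^sup>2 / 2)"
      unfolding exp_sum[OF finite, symmetric] power2_norm_eq_inner inner_vec_def
      by (simp add: sum_distrib_left power2_eq_square mult_ac flip: sum_divide_distrib)
    also have "\<dots> \<le> exp (\<sigma>\<^sup>2 * s\<^sup>2 * r\<^sup>2 / 2)"
      using r by (auto intro!: mult_left_mono power_mono)
    also have "\<sigma>\<^sup>2 * s\<^sup>2 * r\<^sup>2 = t\<^sup>2"
      using 3 \<sigma> by (simp add: s_def power_divide power_mult_distrib)
    finally have mgf: "expectation (\<lambda>\<omega>. exp (s * (a \<bullet> \<epsilon> \<omega>))) \<le> exp (t\<^sup>2 / 2)" .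
    have "prob {\<omega> \<in> space M. \<sigma> * r * t < a \<bullet> \<epsilon> \<omega>} \<le> prob {\<omega> \<in> space M. a \<bullet> \<epsilon> \<omega> \<ge> \<sigma> * r * t}"
      by (rule finite_measure_mono) auto
    also have "\<dots> \<le> exp (- s * (\<sigma> * r * t)) * (LINT \<omega>:space M|M. exp (s * (a \<bullet> \<epsilon> \<omega>)))"
      using integrable_mult_indicator[OF sets.top int]
      by (intro Chernoff_ineq_ge[OF s]) (simp_all add: set_integrable_def)
    also have "(LINT \<omega>:space M|M. exp (s * (a \<bullet> \<epsilon> \<omega>))) = expectation (\<lambda>\<omega>. exp (s * (a \<bullet> \<epsilon> \<omega>)))"
      by (rule set_integral_space[OF int])
    also have "- s * (\<sigma> * r * t) = - t\<^sup>2"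
      using 3 \<sigma> by (simp add: s_def power2_eq_square)
    also have "exp (- t\<^sup>2) * expectation (\<lambda>\<omega>. exp (s * (a \<bullet> \<epsilon> \<omega>))) \<le> exp (- t\<^sup>2) * exp (t\<^sup>2 / 2)"
      using mgf by (intro mult_left_mono) auto
    also have "\<dots> = exp (- (t\<^sup>2 / 2))"
      by (simp flip: exp_add)
    finally show ?thesis .
  qed simp
qed

section \<open>Union bound over the noise events\<close>

theorem theorem3:
  fixes P :: "'w measure"
    and X :: "real ^ 'p::finite ^ 'n::finite"
    and y \<epsilon> :: "'w \<Rightarrow> real ^ 'n"
    and \<beta>s :: "real ^ 'p"
    and S :: "'p set"
    and \<sigma> M b bt :: real
  assumes "prob_space P"
    and "\<And>j. (norm (column j X))\<^sup>2 = real CARD('n)"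
    and "\<And>\<omega>. \<omega> \<in> space P \<Longrightarrow> y \<omega> = X *v \<beta>s + \<epsilon> \<omega>"
    and "0 \<le> \<beta>s"
    and "S = {j. \<beta>s $ j > 0}"
    and "1 \<le> card S" and "card S < CARD('n)"
    and "prob_space.indep_vars P (\<lambda>_. borel) (\<lambda>i \<omega>. \<epsilon> \<omega> $ i) UNIV"
    and "\<And>i k. distr P borel (\<lambda>\<omega>. \<epsilon> \<omega> $ i) = distr P borel (\<lambda>\<omega>. \<epsilon> \<omega> $ k)"
    and "\<And>i. sub_gaussian P (\<lambda>\<omega>. \<epsilon> \<omega> $ i) \<sigma>"
    and "invertible_on S (gram X)"
    and "sep_const X S > 0"
    and "M \<ge> 0"
    and "b = 2 * (1 + M) * \<sigma> * sqrt (2 * ln (real CARD('p)) / real CARD('n)) / (sep_const X S)\<^sup>2"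
    and "bt = b * K_const X S +
              (1 + M) * \<sigma> / sqrt (phi_min X S) * sqrt (2 * ln (real CARD('p)) / real CARD('n))"
    and "beta_min \<beta>s S > bt"
  shows "measure P {\<omega> \<in> space P. \<forall>\<beta>. nnls_minimizer X (y \<omega>) \<beta> \<longrightarrow>
             l1norm (subvec (-S) \<beta>) \<le> b \<and> infnorm (subvec S \<beta> - subvec S \<beta>s) \<le> bt}
           \<ge> 1 - 4 * real CARD('p) powr (- (M\<^sup>2))"
proof -
  interpret prob_space P by fact
  let ?n = "real CARD('n)" and ?p = "real CARD('p)"
  have S: "S \<noteq> {}"
    using assms(6) by auto
  interpret nnls_design X S
    using assms(2,11,12) S by unfold_locales auto
  have \<sigma>: "\<sigma> > 0"
    using assms(10) by (simp add: sub_gaussian_def)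
  have phi: "phi_min X S > 0"
    by (rule phi_min_pos_le[OF assms(11) S])
  have p: "?p \<ge> 1"
    by simp
  \<comment> \<open>Chosen so that a single tail \<open>exp (- (t\<^sup>2 / 2))\<close> equals p to
    the power - (1 + M)^2.\<close>
  define t where "t = (1 + M) * sqrt (2 * ln ?p)"
  define \<mu> where "\<mu> = \<sigma> * t / sqrt ?n"
  define r where "r = 1 / sqrt (phi_min X S * ?n)"
  define a where "a j = (1 / ?n) *\<^sub>R (X *v row j (inv_on S (gram X)))" for j
  have t: "0 \<le> t"
    using \<open>M \<ge> 0\<close> p by (simp add: t_def)
  then have \<mu>: "0 \<le> \<mu>"
    using \<sigma> by (simp add: \<mu>_def)
  have \<kappa>: "0 \<le> \<sigma> * r * t"
    using \<sigma> t phi by (simp add: r_def)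
  \<comment> \<open>\<open>b\<close> is twice the bound that \<open>nnls_minimizer_bounds\<close>
    provides.\<close>
  have b: "b = 2 * (\<mu> / (sep_const X S)\<^sup>2)"
    by (simp add: assms(14) \<mu>_def t_def real_sqrt_divide)
  have bt: "bt = b * K_const X S + \<sigma> * r * t"
    by (simp add: assms(15) r_def t_def real_sqrt_divide real_sqrt_mult)
  have "0 \<le> \<mu> / (sep_const X S)\<^sup>2"
    using \<mu> by simp
  then have half: "\<mu> / (sep_const X S)\<^sup>2 \<le> b"
    unfolding b by linarith
  then have half': "\<mu> / (sep_const X S)\<^sup>2 * K_const X S + \<sigma> * r * t \<le> bt"
    unfolding bt using mult_right_mono[OF half K_const_nonneg_bound(1)[OF S, of X]] by linarith
  have \<beta>s: "\<beta>s \<in> coord_space S"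
    using \<open>0 \<le> \<beta>s\<close> \<open>S = _\<close> by (auto simp: coord_space_def less_eq_vec_def order_antisym)
  have [measurable]: "\<epsilon> \<in> borel_measurable P"
    using assms(8) by (intro borel_measurable_vecI) (auto simp: indep_vars_def)
  \<comment> \<open>On \<open>S\<close> the regression of the noise is controlled from both sides,
    off \<open>S\<close> the projected noise only from above; each index costs at most two
    tails.\<close>
  define Bad where "Bad j = (if j \<in> S
      then {\<omega> \<in> space P. \<sigma> * r * t < a j \<bullet> \<epsilon> \<omega>} \<union> {\<omega> \<in> space P. \<sigma> * r * t < (- a j) \<bullet> \<epsilon> \<omega>}
      else {\<omega> \<in> space P. \<sigma> * sqrt ?n * t < resid (column j X) \<bullet> \<epsilon> \<omega>})" for j
  have Bad_sets [measurable]: "Bad j \<in> events" for j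
    by (simp add: Bad_def)
  have Bad_prob: "prob (Bad j) \<le> 2 * exp (- (t\<^sup>2 / 2))" for j
  proof (cases "j \<in> S")
    case True
    have "norm (a j) \<le> r"
      using norm_coef_row[OF True] by (simp add: a_def r_def)
    then have "prob {\<omega> \<in> space P. \<sigma> * r * t < a j \<bullet> \<epsilon> \<omega>} \<le> exp (- (t\<^sup>2 / 2))"
      and "prob {\<omega> \<in> space P. \<sigma> * r * t < (- a j) \<bullet> \<epsilon> \<omega>} \<le> exp (- (t\<^sup>2 / 2))"
      by (intro sub_gaussian_inner_tail assms t; simp)+
    moreover have "prob (Bad j) \<le> prob {\<omega> \<in> space P. \<sigma> * r * t < a j \<bullet> \<epsilon> \<omega>}
        + prob {\<omega> \<in> space P. \<sigma> * r * t < (- a j) \<bullet> \<epsilon> \<omega>}"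
      using True unfolding Bad_def by (simp only: if_True) (rule measure_Un_le; measurable)
    ultimately show ?thesis by linarith
  next
    case False
    \<comment> \<open>Projecting does not lengthen a column, whose norm is
      \<open>sqrt ?n\<close>.\<close>
    have "norm (resid (column j X)) \<le> sqrt ?n"
      using norm_resid_le[of "column j X"] by (simp add: norm_column)
    then have "prob {\<omega> \<in> space P. \<sigma> * sqrt ?n * t < resid (column j X) \<bullet> \<epsilon> \<omega>} \<le> exp (- (t\<^sup>2 / 2))"
      by (intro sub_gaussian_inner_tail assms t)
    then have "prob (Bad j) \<le> exp (- (t\<^sup>2 / 2))"
      using False by (simp only: Bad_def if_False)
    then show ?thesis
      using exp_ge_zero[of "- (t\<^sup>2 / 2)"] by linarith
  qed
  have "prob (\<Union>j. Bad j) \<le> (\<Sum>j\<in>UNIV. prob (Bad j))"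
    by (rule finite_measure_subadditive_finite) auto
  also have "\<dots> \<le> ?p * (2 * exp (- (t\<^sup>2 / 2)))"
    using sum_bounded_above[of UNIV "\<lambda>j. prob (Bad j)"] Bad_prob by simp
  also have "exp (- (t\<^sup>2 / 2)) = ?p powr (- ((1 + M)\<^sup>2))"
    using p by (simp add: t_def power_mult_distrib powr_def)
  also have "?p * (2 * ?p powr (- ((1 + M)\<^sup>2))) = 2 * ?p powr (1 - (1 + M)\<^sup>2)"
    using p by (simp add: powr_diff powr_minus divide_inverse)
  \<comment> \<open>The exponent 1 - (1 + M)^2 is - M^2 - 2 M, and the base is at least 1.\<close>
  also have "\<dots> \<le> 4 * ?p powr (- (M\<^sup>2))"
  proof -
    have "1 - (1 + M)\<^sup>2 \<le> - (M\<^sup>2)"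
      using \<open>M \<ge> 0\<close> by (simp add: power2_eq_square algebra_simps)
    then have "?p powr (1 - (1 + M)\<^sup>2) \<le> ?p powr (- (M\<^sup>2))"
      using p by (intro powr_mono)
    then show ?thesis
      using powr_ge_zero[of ?p "- (M\<^sup>2)"] by linarith
  qed
  finally have Bad: "prob (\<Union>j. Bad j) \<le> 4 * ?p powr (- (M\<^sup>2))" .
  let ?G = "{z. \<forall>\<beta>. nnls_minimizer X z \<beta> \<longrightarrow>
    l1norm (subvec (-S) \<beta>) \<le> b \<and> infnorm (subvec S \<beta> - subvec S \<beta>s) \<le> bt}"
  let ?E = "{\<omega> \<in> space P. y \<omega> \<in> ?G}"
  have G [measurable]: "?G \<in> sets borel"
    by (rule borel_nnls_event)
  \<comment> \<open>The model equation is given on \<open>space P\<close>; expressed through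
    \<epsilon>, the event is the preimage of a Borel set under a measurable map.\<close>
  have "?E = {\<omega> \<in> space P. X *v \<beta>s + \<epsilon> \<omega> \<in> ?G}"
    using assms(3) by auto
  also have "\<dots> \<in> events"
    by measurable
  finally have E: "?E \<in> events" .
  have "space P - (\<Union>j. Bad j) \<subseteq> ?E"
  proof
    fix \<omega> assume \<omega>: "\<omega> \<in> space P - (\<Union>j. Bad j)"
    have off: "resid (column j X) \<bullet> \<epsilon> \<omega> \<le> ?n * \<mu>" if "j \<notin> S" for j
    proof -
      have "resid (column j X) \<bullet> \<epsilon> \<omega> \<le> \<sigma> * sqrt ?n * t"
        using \<omega> that by (auto simp: Bad_def not_less split: if_splits)
      also have "\<dots> = ?n * \<mu>"
        by (simp add: \<mu>_def field_simps)
      finally show ?thesis .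
    qed
    have on: "\<bar>coef (\<epsilon> \<omega>) $ j\<bar> \<le> \<sigma> * r * t" if "j \<in> S" for j
    proof -
      have "\<omega> \<notin> Bad j" using \<omega> by blast
      then show ?thesis
        using \<omega> that unfolding coef_nth[OF that] a_def[symmetric] by (auto simp: Bad_def not_less)
    qed
    have "beta_min \<beta>s S > \<mu> / (sep_const X S)\<^sup>2 * K_const X S + \<sigma> * r * t"
      using half' assms(16) by linarith
    then have "l1norm (subvec (-S) \<beta>) \<le> b \<and> infnorm (subvec S \<beta> - subvec S \<beta>s) \<le> bt"
      if "nnls_minimizer X (y \<omega>) \<beta>" for \<beta>
      using nnls_minimizer_bounds[OF that _ \<beta>s \<mu> off \<kappa> on] assms(3)[of \<omega>] \<omega> half half'
      by (auto simp: subvec_eq[OF \<beta>s])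
    with \<omega> show "\<omega> \<in> ?E" by auto
  qed
  then have "prob (space P - (\<Union>j. Bad j)) \<le> prob ?E"
    by (intro finite_measure_mono E)
  moreover have "prob (space P - (\<Union>j. Bad j)) = 1 - prob (\<Union>j. Bad j)"
    by (intro prob_compl) measurable
  ultimately show ?thesis
    using Bad by simp
qed

end
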